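(* Let $n\ge 2$, $v=(4^n-2^n)/2$ and $1\le s<v$. For $\bar S=\{g_{s+1},\ldots,g_v\}\subset\Omega$ a set of $v-s$ (distinct) vectors with distinguished element $g_{s+1}$, let $$F_{\mathrm{odd},3}=3(2^{n})\sum_{u\in\Delta_0}\bar\sigma_{\mathrm{odd},u}^{2}+\sum_{u\in\Delta}\bar\sigma_{\mathrm{odd},u}^{3}.$$ Then: (a) The inequality $F_{\mathrm{odd},3}\le 3(2^{2n})\{2(v-s)-1\}^2$ holds for every such $\bar S$. (b) Equality holds in (a) if and only if $\bar S$ is even.
   Context: $Z_4=\{0,1,2,3\}$ denotes the integers mod 4; an element of $Z_4$ is even if it is 0 or 2 and odd otherwise. $\Delta=Z_4^n$ is the set of all $n\times 1$ vectors over $Z_4$, and $\Delta_0\subset\Delta$ is the set of the $2^n$ vectors all of whose elements are even. $\Omega\subset\Delta$ is the set of all vectors having at least one odd element and whose first odd element equals 1; it has exactly $v=(4^n-2^n)/2$ elements. With $i=\sqrt{-1}$, for any integer $z$ let $\psi(z)=(i^{z}+i^{3-z})/(1-i)$ (this depends only on $z$ mod 4). With primes denoting transposition, for $u\in\Delta$, $$\bar\sigma_{\mathrm{odd},u}=\psi(u'g_{s+1})+\sum_{j=s+2}^{v}\{\psi(-u'g_j)+\psi(u'g_j)\}.$$ The set $\bar S=\{g_{s+1},\ldots,g_v\}$ is called even if $g_j+g_k$ has all elements even for every $s+1\le j,k\le v$. *)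

theory Defs
  imports Complex_Main "HOL-Library.FuncSet"
begin

text \<open>
  Elements of $Z_4$ are represented by the integers $0,1,2,3$ (so that parity is parity
  of integers), and $n \times 1$ vectors over $Z_4$ by extensional functions on the index
  set $\{1,\ldots,n\}$.
\<close>

definition Delta :: "nat \<Rightarrow> (nat \<Rightarrow> int) set" where
  "Delta n = {1..n} \<rightarrow>\<^sub>E {0, 1, 2, 3}"

definition vec_add :: "nat \<Rightarrow> (nat \<Rightarrow> int) \<Rightarrow> (nat \<Rightarrow> int) \<Rightarrow> (nat \<Rightarrow> int)" where
  "vec_add n x y = (\<lambda>i\<in>{1..n}. (x i + y i) mod 4)"

definition all_even :: "nat \<Rightarrow> (nat \<Rightarrow> int) \<Rightarrow> bool" where
  "all_even n x \<longleftrightarrow> (\<forall>i\<in>{1..n}. even (x i))"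

definition Delta0 :: "nat \<Rightarrow> (nat \<Rightarrow> int) set" where
  "Delta0 n = {u \<in> Delta n. all_even n u}"

definition Omega :: "nat \<Rightarrow> (nat \<Rightarrow> int) set" where
  "Omega n = {x \<in> Delta n. \<exists>i\<in>{1..n}. odd (x i) \<and> (\<forall>k\<in>{1..<i}. even (x k)) \<and> x i = 1}"

text \<open>The division is exact.\<close>

definition vnum :: "nat \<Rightarrow> nat" where
  "vnum n = (4 ^ n - 2 ^ n) div 2"

definition psi :: "int \<Rightarrow> complex" where
  "psi z = (\<i> powi z + \<i> powi (3 - z)) / (1 - \<i>)"

text \<open>
  The product $u'x$ is taken in the integers, without reduction mod 4; it is only ever
  used as an argument of \<open>psi\<close>, which has period 4.
\<close>

definition dot :: "nat \<Rightarrow> (nat \<Rightarrow> int) \<Rightarrow> (nat \<Rightarrow> int) \<Rightarrow> int" where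
  "dot n u x = (\<Sum>i\<in>{1..n}. u i * x i)"

lemma psi_mod_4: "psi (z mod 4) = psi z"
proof -
  have four: "\<i> powi (4 * k) = 1" for k :: int
    by (simp add: power_int_mult eval_nat_numeral)
  have z: "\<i> powi z = \<i> powi (z mod 4)"
  proof -
    have "\<i> powi z = \<i> powi (4 * (z div 4) + z mod 4)"
      by simp
    also have "\<dots> = \<i> powi (z mod 4)"
      by (subst power_int_add) (simp_all add: four)
    finally show ?thesis .
  qed
  moreover have "\<i> powi (3 - z) = \<i> powi (3 - z mod 4)"
  proof -
    have "3 - z = 4 * (- (z div 4)) + (3 - z mod 4)"
      using mult_div_mod_eq[of 4 z] by linarith
    then have "\<i> powi (3 - z) = \<i> powi (4 * (- (z div 4)) + (3 - z mod 4))"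
      by (rule arg_cong)
    also have "\<dots> = \<i> powi (3 - z mod 4)"
      by (subst power_int_add) (simp_all only: four, simp_all)
    finally show ?thesis .
  qed
  ultimately show ?thesis
    by (simp add: psi_def)
qed

text \<open>
  The set $\bar S$ is given by an enumeration \<open>g\<close>, of which only the values at the
  indices $s+1,\ldots,v$ matter.
\<close>

definition sigma_odd :: "nat \<Rightarrow> nat \<Rightarrow> (nat \<Rightarrow> nat \<Rightarrow> int) \<Rightarrow> (nat \<Rightarrow> int) \<Rightarrow> complex" where
  "sigma_odd n s g u =
     psi (dot n u (g (s + 1)))
     + (\<Sum>j = s + 2..vnum n. psi (- dot n u (g j)) + psi (dot n u (g j)))"

definition F_odd3 :: "nat \<Rightarrow> nat \<Rightarrow> (nat \<Rightarrow> nat \<Rightarrow> int) \<Rightarrow> complex" where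
  "F_odd3 n s g =
     3 * 2 ^ n * (\<Sum>u\<in>Delta0 n. (sigma_odd n s g u)\<^sup>2) + (\<Sum>u\<in>Delta n. (sigma_odd n s g u) ^ 3)"

definition even_family :: "nat \<Rightarrow> nat \<Rightarrow> (nat \<Rightarrow> nat \<Rightarrow> int) \<Rightarrow> bool" where
  "even_family n s g \<longleftrightarrow>
     (\<forall>j\<in>{s + 1..vnum n}. \<forall>k\<in>{s + 1..vnum n}. all_even n (vec_add n (g j) (g k)))"

end

theory Submission
  imports Defs
begin

text \<open>
  Since $\psi(z) = \frac{1+i}2 i^z + \frac{1-i}2 i^{-z}$, the function $\bar\sigma$ is the character
  sum $\sum_x w(x)\, i^{u'x}$ over the $2(v-s)$ vectors $\pm g_j$, with $w(\pm g_{s+1}) = (1 \pm i)/2$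
  and $w = 1$ elsewhere. These weights sum to $2(v-s)-1$. By orthogonality of characters,
  $4^{-n} F = 3 \sum w(x) w(y) + \sum w(x) w(y) w(z)$, the first sum over the pairs with $x+y$
  even, the second over the triples with $x+y+z=0$. Let $P$ be the sum of $w(x)w(y)$ over the pairs
  with $x+y$ not even, so that the first sum is $(2(v-s)-1)^2 - P$. In a triple with zero sum no two
  terms are congruent mod 2, so $(x,y)$ is a pair counted by $P$; it determines $z$, and
  $\mathrm{Re}(w(x)w(y)w(z)) \le \mathrm{Re}(w(x)w(y))$. Hence the second sum is at most $P$, and
  $F \le 4^n (3(2(v-s)-1)^2 - 2P)$. The terms of $P$ have real part at least $1/2$, so $P = 0$ only
  if there are none, that is, if $\bar S$ is even.
\<close>

section \<open>Powers of \<open>i\<close> and the function \<open>psi\<close>\<close>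

lemma i_powi_mod_4: "\<i> powi z = \<i> powi (z mod 4)"
proof -
  have "\<i> powi z = \<i> powi (4 * (z div 4) + z mod 4)"
    by simp
  also have "\<dots> = \<i> powi (z mod 4)"
    by (subst power_int_add) (simp_all add: power_int_mult eval_nat_numeral)
  finally show ?thesis .
qed

lemma i_powi_cases:
  obtains "z mod 4 = 0" "\<i> powi z = 1" | "z mod 4 = 1" "\<i> powi z = \<i>"
    | "z mod 4 = 2" "\<i> powi z = -1" | "z mod 4 = 3" "\<i> powi z = -\<i>"
proof -
  have vals: "\<i> powi 2 = -1" "\<i> powi 3 = -\<i>"
    by (simp_all add: power_int_def eval_nat_numeral)
  consider "z mod 4 = 0" | "z mod 4 = 1" | "z mod 4 = 2" | "z mod 4 = 3"
    by linarith
  then show thesis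
    using that i_powi_mod_4[of z] by cases (simp_all add: vals del: power_int_numeral)
qed

text \<open>Uses \<open>i^3 = -i\<close> and \<open>1/(1 - i) = (1 + i)/2\<close>. The two summands
  are complex conjugates.\<close>

lemma psi_eq: "psi z = (1 + \<i>) / 2 * \<i> powi z + (1 - \<i>) / 2 * \<i> powi (- z)"
proof -
  have "\<i> powi (3 - z) = - \<i> * \<i> powi (- z)"
    using power_int_add[of \<i> 3 "- z"] by (simp add: power_int_def eval_nat_numeral)
  then show ?thesis
    by (simp add: psi_def field_simps)
qed

lemma psi_real: "psi z \<in> \<real>"
  by (cases z rule: i_powi_cases) (simp_all add: psi_eq power_int_minus complex_is_Real_iff)

section \<open>Orthogonality of characters\<close>

text \<open>A geometric sum over a fourth root of unity, which vanishes unless \<open>i^x\<close> is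
  1.\<close>

lemma sum_i_powi_Z4: "(\<Sum>k\<in>{0, 1, 2, 3}. \<i> powi (k * x)) = (if 4 dvd x then 4 else 0)"
proof -
  have "(\<Sum>k\<in>{0, 1, 2, 3}. \<i> powi (k * x)) = (\<Sum>k\<in>{0, 1, 2, 3}. (\<i> powi x) powi k)"
    by (simp only: mult.commute[of _ x] power_int_mult)
  then show ?thesis
    by (cases x rule: i_powi_cases)
      (simp_all add: dvd_eq_mod_eq_0 power_int_def eval_nat_numeral)
qed

lemma sum_i_powi_even: "(\<Sum>k\<in>{0, 2}. \<i> powi (k * x)) = (if even x then 2 else 0)"
proof -
  have "(\<Sum>k\<in>{0, 2}. \<i> powi (k * x)) = (\<Sum>k\<in>{0, 2}. (\<i> powi x) powi k)"
    by (simp only: mult.commute[of _ x] power_int_mult)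
  moreover have "even x \<longleftrightarrow> x mod 4 = 0 \<or> x mod 4 = 2"
    by presburger
  ultimately show ?thesis
    by (cases x rule: i_powi_cases) (simp_all add: power_int_def eval_nat_numeral)
qed

lemma i_powi_dot: "\<i> powi dot n u x = (\<Prod>i\<in>{1..n}. \<i> powi (u i * x i))"
proof -
  have "\<i> powi (\<Sum>i\<in>A. u i * x i) = (\<Prod>i\<in>A. \<i> powi (u i * x i))" if "finite A" for A
    using that by induction (simp_all add: power_int_add)
  then show ?thesis
    by (simp add: dot_def)
qed

lemma Delta0_eq: "Delta0 n = {1..n} \<rightarrow>\<^sub>E {0, 2}"
proof -
  have "{k \<in> {0, 1, 2, 3}. even k} = {0, 2 :: int}"
    by auto
  then show ?thesis
    unfolding Delta0_def Delta_def all_even_def PiE_iff set_eq_iff by blast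
qed

text \<open>A character of a vector is a product over coordinates, so summing over a product set
  factors. One vanishing coordinate sum then kills the whole sum.\<close>

lemma sum_PiE_dot:
  assumes "finite B"
  shows "(\<Sum>u\<in>{1..n} \<rightarrow>\<^sub>E B. \<i> powi dot n u x) = (\<Prod>i\<in>{1..n}. \<Sum>k\<in>B. \<i> powi (k * x i))"
  unfolding i_powi_dot using assms by (subst prod_sum_PiE) auto

lemma sum_Delta_dot:
  "(\<Sum>u\<in>Delta n. \<i> powi dot n u x) = (if \<forall>i\<in>{1..n}. 4 dvd x i then 4 ^ n else 0)"
  unfolding Delta_def by (subst sum_PiE_dot) (auto simp: sum_i_powi_Z4)

lemma sum_Delta0_dot:
  "(\<Sum>u\<in>Delta0 n. \<i> powi dot n u x) = (if all_even n x then 2 ^ n else 0)"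
  unfolding Delta0_eq by (subst sum_PiE_dot) (auto simp: sum_i_powi_even all_even_def)

lemma dot_add: "dot n u (\<lambda>i. x i + y i) = dot n u x + dot n u y"
  by (simp add: dot_def sum.distrib algebra_simps)

lemma sum_Delta_cube:
  "(\<Sum>u\<in>Delta n. (\<Sum>p\<in>J. w p * \<i> powi dot n u (f p)) ^ 3) =
    4 ^ n * (\<Sum>p\<in>J. \<Sum>q\<in>J. \<Sum>r\<in>J.
      if \<forall>i\<in>{1..n}. 4 dvd f p i + f q i + f r i then w p * w q * w r else 0)"
proof -
  have "(\<Sum>u\<in>Delta n. (\<Sum>p\<in>J. w p * \<i> powi dot n u (f p)) ^ 3) =
      (\<Sum>u\<in>Delta n. \<Sum>p\<in>J. \<Sum>q\<in>J. \<Sum>r\<in>J.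
         w p * w q * w r * \<i> powi dot n u (\<lambda>i. f p i + f q i + f r i))"
    unfolding power3_eq_cube sum_product sum_distrib_right sum_distrib_left dot_add
    by (intro sum.cong refl) (simp add: power_int_add)
  \<comment> \<open>The sum over \<open>u\<close> moves inside those over \<open>p\<close>,
    \<open>q\<close>, \<open>r\<close>, where orthogonality evaluates it.\<close>
  also have "\<dots> = (\<Sum>p\<in>J. \<Sum>q\<in>J. \<Sum>r\<in>J. \<Sum>u\<in>Delta n.
         w p * w q * w r * \<i> powi dot n u (\<lambda>i. f p i + f q i + f r i))"
    by (subst sum.swap, intro sum.cong refl, subst sum.swap, intro sum.cong refl, rule sum.swap)
  finally show ?thesis
    unfolding sum_distrib_left[symmetric] sum_Delta_dot
    by (simp add: sum_distrib_left if_distrib mult_ac cong: if_cong)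
qed

lemma sum_Delta0_square:
  "(\<Sum>u\<in>Delta0 n. (\<Sum>p\<in>J. w p * \<i> powi dot n u (f p))\<^sup>2) =
    2 ^ n * (\<Sum>p\<in>J. \<Sum>q\<in>J. if all_even n (\<lambda>i. f p i + f q i) then w p * w q else 0)"
proof -
  have "(\<Sum>u\<in>Delta0 n. (\<Sum>p\<in>J. w p * \<i> powi dot n u (f p))\<^sup>2) =
      (\<Sum>u\<in>Delta0 n. \<Sum>p\<in>J. \<Sum>q\<in>J. w p * w q * \<i> powi dot n u (\<lambda>i. f p i + f q i))"
    unfolding power2_eq_square sum_product dot_add
    by (intro sum.cong refl) (simp add: power_int_add)
  also have "\<dots> = (\<Sum>p\<in>J. \<Sum>q\<in>J. \<Sum>u\<in>Delta0 n.
         w p * w q * \<i> powi dot n u (\<lambda>i. f p i + f q i))"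
    by (subst sum.swap, intro sum.cong refl, rule sum.swap)
  finally show ?thesis
    unfolding sum_distrib_left[symmetric] sum_Delta0_dot
    by (simp add: sum_distrib_left if_distrib mult_ac cong: if_cong)
qed

section \<open>Vectors of Omega modulo 4\<close>

lemma Omega_odd: "x \<in> Omega n \<Longrightarrow> \<exists>i\<in>{1..n}. odd (x i)"
  by (auto simp: Omega_def)

lemma Omega_eq_if_cong:
  assumes "x \<in> Omega n" "y \<in> Omega n" "\<forall>i\<in>{1..n}. 4 dvd x i - y i"
  shows "x = y"
proof (rule PiE_ext)
  show "x \<in> {1..n} \<rightarrow>\<^sub>E {0, 1, 2, 3}" "y \<in> {1..n} \<rightarrow>\<^sub>E {0, 1, 2, 3}"
    using assms by (auto simp: Omega_def Delta_def)
  fix i assume i: "i \<in> {1..n}"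
  then have "x i \<in> {0, 1, 2, 3}" "y i \<in> {0, 1, 2, 3}"
    using assms by (auto simp: Omega_def Delta_def)
  then show "x i = y i"
    using assms(3) i by fastforce
qed

text \<open>If \<open>x\<close> were congruent to \<open>-y\<close>, both would have the same odd
  positions, hence the same first one. There both entries are 1, and 1 + 1 is not divisible by
  4.\<close>

lemma Omega_not_cong_uminus:
  assumes "x \<in> Omega n" "y \<in> Omega n"
  shows "\<not> (\<forall>i\<in>{1..n}. 4 dvd x i + y i)"
proof
  assume *: "\<forall>i\<in>{1..n}. 4 dvd x i + y i"
  then have par: "even (x k) \<longleftrightarrow> even (y k)" if "k \<in> {1..n}" for k
    using that by (meson dvd_trans even_add even_numeral)
  obtain i where i: "i \<in> {1..n}" "\<forall>k\<in>{1..<i}. even (x k)" "x i = 1"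
    using assms(1) by (auto simp: Omega_def)
  obtain j where j: "j \<in> {1..n}" "\<forall>k\<in>{1..<j}. even (y k)" "y j = 1"
    using assms(2) by (auto simp: Omega_def)
  have "odd (y i)" "odd (x j)"
    using par[OF i(1)] par[OF j(1)] i(3) j(3) by auto
  then have "\<not> i < j" "\<not> j < i"
    using i j by auto
  then have "i = j"
    by simp
  then show False
    using * i j by fastforce
qed

section \<open>Sigma as a weighted character sum\<close>

text \<open>The pair \<open>(j, e)\<close> with \<open>e \<in> {1, -1}\<close> indexes the vector $e\, g_j$.\<close>

definition signed_vec :: "(nat \<Rightarrow> nat \<Rightarrow> int) \<Rightarrow> nat \<times> int \<Rightarrow> nat \<Rightarrow> int" where
  "signed_vec g p i = snd p * g (fst p) i"

text \<open>\<open>a\<close> is the index of the distinguished vector; its two weights are the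
  coefficients in \<open>psi_eq\<close>.\<close>

definition weight :: "nat \<Rightarrow> nat \<times> int \<Rightarrow> complex" where
  "weight a p = (if fst p = a then (1 + of_int (snd p) * \<i>) / 2 else 1)"

lemma sigma_odd_eq:
  assumes "s < vnum n"
  shows "sigma_odd n s g u =
    (\<Sum>p\<in>{s + 1..vnum n} \<times> {1, -1}. weight (s + 1) p * \<i> powi dot n u (signed_vec g p))"
proof -
  have neg: "dot n u (\<lambda>i. - x i) = - dot n u x" for x
    by (simp add: dot_def sum_negf)
  have split: "{s + 1..vnum n} = insert (s + 1) {s + 2..vnum n}"
    using assms by auto
  have "(\<Sum>p\<in>{s + 1..vnum n} \<times> {1, -1}. weight (s + 1) p * \<i> powi dot n u (signed_vec g p)) =
    (\<Sum>j\<in>{s + 1..vnum n}. weight (s + 1) (j, 1) * \<i> powi dot n u (g j) +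
       weight (s + 1) (j, -1) * \<i> powi (- dot n u (g j)))"
    unfolding sum.cartesian_product'
    by (simp add: signed_vec_def[abs_def] neg)
  also have "\<dots> = (1 + \<i>) / 2 * \<i> powi dot n u (g (s + 1)) + (1 - \<i>) / 2 * \<i> powi (- dot n u (g (s + 1)))
      + (\<Sum>j\<in>{s + 2..vnum n}. \<i> powi dot n u (g j) + \<i> powi (- dot n u (g j)))"
    unfolding split by (simp add: weight_def)
  \<comment> \<open>The coefficients \<open>(1 + i)/2\<close> and \<open>(1 - i)/2\<close> add up to
    1, which gives weight 1 to both signs.\<close>
  moreover have "psi (- z) + psi z = \<i> powi z + \<i> powi (- z)" for z
    by (simp add: psi_eq field_simps)
  ultimately show ?thesis
    by (simp only: sigma_odd_def psi_eq[of "dot n u (g (s + 1))"])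
qed

text \<open>The distinguished index contributes 1 and every other index 2, whence the -1.\<close>

lemma sum_weight:
  assumes "s < v"
  shows "(\<Sum>p\<in>{s + 1..v} \<times> {1, -1}. weight (s + 1) p) = of_real (2 * (real v - real s) - 1)"
proof -
  have "(\<Sum>p\<in>{s + 1..v} \<times> {1, -1}. weight (s + 1) p) =
      (\<Sum>j\<in>insert (s + 1) {s + 2..v}. weight (s + 1) (j, 1) + weight (s + 1) (j, -1))"
    unfolding sum.cartesian_product' using assms by (intro sum.cong) auto
  also have "\<dots> = 1 + (\<Sum>j\<in>{s + 2..v}. 2)"
    by (simp add: weight_def field_simps)
  also have "\<dots> = of_real (2 * (real v - real s) - 1)"
    using assms by (simp add: of_nat_diff)
  finally show ?thesis .
qed

text \<open>At most one factor belongs to \<open>a\<close>, so the real part is 1 or 1/2.\<close>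

lemma Re_weight_pair:
  assumes "fst p \<noteq> fst q"
  shows "Re (weight a p * weight a q) \<ge> 1 / 2"
  using assms by (auto simp: weight_def)

text \<open>If \<open>r\<close> has index \<open>a\<close>, the left side is 1/2 and the right side
  1; otherwise the third factor is 1.\<close>

lemma Re_weight_triple:
  assumes "fst p \<noteq> fst q" "fst p \<noteq> fst r" "fst q \<noteq> fst r"
  shows "Re (weight a p * weight a q * weight a r) \<le> Re (weight a p * weight a q)"
  using assms by (auto simp: weight_def)

section \<open>Pairs and triples of signed vectors\<close>

context
  fixes n :: nat and g :: "nat \<Rightarrow> nat \<Rightarrow> int" and I :: "nat set"
  assumes finite_I: "finite I" and g_Omega: "g ` I \<subseteq> Omega n" and g_inj: "inj_on g I"
begin

lemma signed_vec_odd: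
  assumes "p \<in> I \<times> {1, -1}"
  shows "\<exists>i\<in>{1..n}. odd (signed_vec g p i)"
  using assms g_Omega Omega_odd[of "g (fst p)" n] by (auto simp: signed_vec_def)

text \<open>Equal signs reduce to \<open>Omega_eq_if_cong\<close> and injectivity of
  \<open>g\<close>; opposite signs are excluded by \<open>Omega_not_cong_uminus\<close>. This makes
  the third member of a zero-sum triple unique.\<close>

lemma signed_vec_cong_imp_eq:
  assumes "p \<in> I \<times> {1, -1}" "q \<in> I \<times> {1, -1}"
    and "\<forall>i\<in>{1..n}. 4 dvd signed_vec g p i - signed_vec g q i"
  shows "p = q"
proof -
  obtain j d k e where pq: "p = (j, d)" "q = (k, e)"
    by (metis surj_pair)
  have mem: "g j \<in> Omega n" "g k \<in> Omega n" "j \<in> I" "k \<in> I"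
    using assms g_Omega pq by auto
  have de: "d = 1 \<or> d = -1" "e = 1 \<or> e = -1"
    using assms pq by auto
  show ?thesis
  proof (cases "d = e")
    case True
    have "4 dvd g j i - g k i" if "i \<in> {1..n}" for i
    proof -
      have "4 dvd d * (g j i - g k i)"
        using assms(3) that True by (simp add: pq signed_vec_def right_diff_distrib)
      then show ?thesis
        using de by (auto simp: dvd_diff_commute)
    qed
    then have "g j = g k"
      using Omega_eq_if_cong[OF mem(1,2)] by blast
    then show ?thesis
      using g_inj mem True pq by (auto dest: inj_onD)
  next
    case False
    have "4 dvd g j i + g k i" if "i \<in> {1..n}" for i
    proof -
      have "e = - d"
        using de False by auto
      then have "4 dvd d * (g j i + g k i)"
        using assms(3) that by (simp add: pq signed_vec_def distrib_left)
      then show ?thesis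
        using de by (auto simp only: mult_1 mult_minus1 dvd_minus_iff)
    qed
    then show ?thesis
      using Omega_not_cong_uminus[OF mem(1,2)] by blast
  qed
qed

text \<open>Two signed copies of one vector add up to 0 or to twice a vector, which is even.\<close>

lemma fst_neq_if_not_all_even:
  assumes "p \<in> I \<times> {1, -1}" "q \<in> I \<times> {1, -1}"
    and "\<not> all_even n (\<lambda>i. signed_vec g p i + signed_vec g q i)"
  shows "fst p \<noteq> fst q"
  using assms by (auto simp: all_even_def signed_vec_def)

text \<open>Where the third vector has an odd entry, the sum of the other two must be odd as
  well.\<close>

lemma not_all_even_if_sum_cong_0:
  assumes "r \<in> I \<times> {1, -1}"
    and "\<forall>i\<in>{1..n}. 4 dvd signed_vec g p i + signed_vec g q i + signed_vec g r i"
  shows "\<not> all_even n (\<lambda>i. signed_vec g p i + signed_vec g q i)"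
proof -
  obtain i where i: "i \<in> {1..n}" "odd (signed_vec g r i)"
    using signed_vec_odd[OF assms(1)] by blast
  have "even (signed_vec g p i + signed_vec g q i + signed_vec g r i)"
    using assms(2) i(1) by (meson dvd_trans even_numeral)
  then show ?thesis
    using i by (auto simp: all_even_def)
qed

text \<open>At most one \<open>r\<close> completes the pair. If there is one, the pair is not even
  and \<open>Re_weight_triple\<close> compares the terms; if there is none, the right side is still
  nonnegative.\<close>

lemma sum_weight_triples_le:
  assumes p: "p \<in> I \<times> {1, -1}" and q: "q \<in> I \<times> {1, -1}"
  shows "(\<Sum>r\<in>I \<times> {1, -1}.
      if \<forall>i\<in>{1..n}. 4 dvd signed_vec g p i + signed_vec g q i + signed_vec g r i
      then Re (weight a p * weight a q * weight a r) else 0) \<le>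
    (if all_even n (\<lambda>i. signed_vec g p i + signed_vec g q i) then 0 else Re (weight a p * weight a q))"
    (is "(\<Sum>r\<in>?J. if ?Z r then _ else 0) \<le> _")
proof (cases "\<exists>r\<in>?J. ?Z r")
  case False
  then have "(\<Sum>r\<in>?J. if ?Z r then Re (weight a p * weight a q * weight a r) else 0) = 0"
    by (intro sum.neutral) auto
  moreover have "0 \<le> Re (weight a p * weight a q)"
    if "\<not> all_even n (\<lambda>i. signed_vec g p i + signed_vec g q i)"
    using Re_weight_pair[OF fst_neq_if_not_all_even[OF p q that], of a] by linarith
  ultimately show ?thesis
    by auto
next
  case True
  then obtain r where r: "r \<in> ?J" "?Z r"
    by blast
  have uniq: "t = r" if "t \<in> ?J" "?Z t" for t
  proof (rule signed_vec_cong_imp_eq[OF that(1) r(1)], rule ballI)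
    fix i assume "i \<in> {1..n}"
    then have "4 dvd (signed_vec g p i + signed_vec g q i + signed_vec g t i) -
        (signed_vec g p i + signed_vec g q i + signed_vec g r i)"
      using that(2) r(2) by (intro dvd_diff) auto
    then show "4 dvd signed_vec g t i - signed_vec g r i"
      by simp
  qed
  have "(\<Sum>t\<in>?J. if ?Z t then Re (weight a p * weight a q * weight a t) else 0) =
      (\<Sum>t\<in>?J. if t = r then Re (weight a p * weight a q * weight a r) else 0)"
  proof (rule sum.cong[OF refl])
    fix t assume "t \<in> ?J"
    then have "?Z t \<longleftrightarrow> t = r"
      using uniq r(2) by blast
    then show "(if ?Z t then Re (weight a p * weight a q * weight a t) else 0) =
        (if t = r then Re (weight a p * weight a q * weight a r) else 0)"
      by (simp only: cong: if_cong)
  qed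
  also have "\<dots> = Re (weight a p * weight a q * weight a r)"
    using r(1) finite_I by (subst sum.delta) simp_all
  also have "\<dots> \<le> Re (weight a p * weight a q)"
  proof (rule Re_weight_triple)
    show "fst p \<noteq> fst q"
      using fst_neq_if_not_all_even[OF p q] not_all_even_if_sum_cong_0[OF r] by blast
    \<comment> \<open>The zero-sum condition is symmetric, so any two of the three vectors may serve
      as the non-even pair.\<close>
    show "fst p \<noteq> fst r"
      using fst_neq_if_not_all_even[OF p r(1)] not_all_even_if_sum_cong_0[OF q, of p r] r(2)
      by (auto simp: add_ac)
    show "fst q \<noteq> fst r"
      using fst_neq_if_not_all_even[OF q r(1)] not_all_even_if_sum_cong_0[OF p, of q r] r(2)
      by (auto simp: add_ac)
  qed
  finally show ?thesis
    using not_all_even_if_sum_cong_0[OF r] by simp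
qed

end

section \<open>The bound and the case of equality\<close>

text \<open>Neither a change of sign nor reduction mod 4 affects parity.\<close>

lemma all_even_signed_vec_iff:
  assumes "d \<in> {1, -1}" "e \<in> {1, -1}"
  shows "all_even n (\<lambda>i. signed_vec g (j, d) i + signed_vec g (k, e) i) \<longleftrightarrow>
    all_even n (vec_add n (g j) (g k))"
proof -
  have "even ((x + y) mod 4) \<longleftrightarrow> even (x + y)" for x y :: int
    by presburger
  then show ?thesis
    using assms by (auto simp: all_even_def signed_vec_def vec_add_def)
qed

theorem theorem3:
  fixes n s :: nat and g :: "nat \<Rightarrow> nat \<Rightarrow> int"
  assumes "n \<ge> 2" and "1 \<le> s" and "s < vnum n"
    and "g ` {s + 1..vnum n} \<subseteq> Omega n"
    and "inj_on g {s + 1..vnum n}"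
  shows "(F_odd3 n s g \<in> \<real> \<and>
          Re (F_odd3 n s g) \<le> 3 * 2 ^ (2 * n) * (2 * (real (vnum n) - real s) - 1)\<^sup>2) \<and>
         (F_odd3 n s g = complex_of_real (3 * 2 ^ (2 * n) * (2 * (real (vnum n) - real s) - 1)\<^sup>2)
         \<longleftrightarrow> even_family n s g)"
proof -
  define J where "J = {s + 1..vnum n} \<times> {1, -1 :: int}"
  define w where "w = weight (s + 1)"
  define f where "f = signed_vec g"
  define E where "E p q \<longleftrightarrow> all_even n (\<lambda>i. f p i + f q i)" for p q
  define Z where "Z p q r \<longleftrightarrow> (\<forall>i\<in>{1..n}. 4 dvd f p i + f q i + f r i)" for p q r
  \<comment> \<open>Real parts suffice in \<open>P\<close> and \<open>T\<close>, because
    \<open>F_odd3\<close> is real although the weights are not.\<close>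
  define P where "P = (\<Sum>p\<in>J. \<Sum>q\<in>J. if E p q then 0 else Re (w p * w q))"
  define T where "T = (\<Sum>p\<in>J. \<Sum>q\<in>J. \<Sum>r\<in>J. if Z p q r then Re (w p * w q * w r) else 0)"
  define m where "m = 2 * (real (vnum n) - real s) - 1"
  have fin: "finite J"
    by (simp add: J_def)
  note I = finite_atLeastAtMost assms(4,5)
  have sigma: "sigma_odd n s g u = (\<Sum>p\<in>J. w p * \<i> powi dot n u (f p))" for u
    using sigma_odd_eq[OF assms(3)] by (simp add: J_def w_def f_def)
  have F_real: "F_odd3 n s g \<in> \<real>"
    unfolding F_odd3_def sigma_odd_def
    by (intro Reals_add Reals_mult Reals_power sum_in_Reals psi_real Reals_numeral)
  have ReF: "Re (F_odd3 n s g) = 4 ^ n * (3 * (m\<^sup>2 - P) + T)"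
  proof -
    \<comment> \<open>\<open>m\<close> is the total weight, so its square sums over all pairs, and
      removing \<open>P\<close> leaves the even ones.\<close>
    have "of_real (m\<^sup>2) = (\<Sum>p\<in>J. \<Sum>q\<in>J. w p * w q)"
      using sum_weight[OF assms(3)]
      by (simp add: m_def J_def w_def power2_eq_square flip: sum_product)
    then have "m\<^sup>2 = Re (\<Sum>p\<in>J. \<Sum>q\<in>J. w p * w q)"
      by (metis Re_complex_of_real)
    then have "m\<^sup>2 - P = (\<Sum>p\<in>J. \<Sum>q\<in>J. Re (w p * w q) - (if E p q then 0 else Re (w p * w q)))"
      by (simp add: P_def sum_subtractf)
    also have "\<dots> = Re (\<Sum>p\<in>J. \<Sum>q\<in>J. if E p q then w p * w q else 0)"
      unfolding Re_sum by (intro sum.cong refl) auto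
    finally have D0: "Re (\<Sum>p\<in>J. \<Sum>q\<in>J. if E p q then w p * w q else 0) = m\<^sup>2 - P" ..
    have D: "Re (\<Sum>p\<in>J. \<Sum>q\<in>J. \<Sum>r\<in>J. if Z p q r then w p * w q * w r else 0) = T"
      unfolding Re_sum T_def by (intro sum.cong refl) auto
    \<comment> \<open>The factor \<open>3 * 4 ^ n\<close> combines \<open>3 * 2 ^ n\<close> from the
      definition with \<open>2 ^ n\<close> from orthogonality over \<open>Delta0 n\<close>.\<close>
    have "F_odd3 n s g = of_real (3 * 4 ^ n) * (\<Sum>p\<in>J. \<Sum>q\<in>J. if E p q then w p * w q else 0)
        + of_real (4 ^ n) * (\<Sum>p\<in>J. \<Sum>q\<in>J. \<Sum>r\<in>J. if Z p q r then w p * w q * w r else 0)"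
      unfolding F_odd3_def sigma sum_Delta_cube sum_Delta0_square E_def Z_def
      by (simp flip: power_mult_distrib mult.assoc)
    then have "Re (F_odd3 n s g) = 3 * 4 ^ n * (m\<^sup>2 - P) + 4 ^ n * T"
      by (simp only: plus_complex.sel times_complex.sel D0 D Re_complex_of_real
          Im_complex_of_real mult_zero_left diff_zero)
    then show ?thesis
      by (simp add: algebra_simps)
  qed
  have TP: "T \<le> P"
    unfolding T_def P_def E_def Z_def J_def w_def f_def
    by (intro sum_mono sum_weight_triples_le[OF I])
  have half: "1 / 2 \<le> Re (w p * w q)" if "p \<in> J" "q \<in> J" "\<not> E p q" for p q
    using Re_weight_pair fst_neq_if_not_all_even[OF I, of p q] that
    by (auto simp: J_def w_def E_def f_def)
  have nonneg: "0 \<le> (if E p q then 0 else Re (w p * w q))" if "p \<in> J" "q \<in> J" for p q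
    using half[OF that] by auto
  have P0: "0 \<le> P"
    unfolding P_def by (intro sum_nonneg nonneg)
  \<comment> \<open>The summands of \<open>P\<close> are nonnegative, and each non-even pair
    contributes at least 1/2.\<close>
  have "P = 0 \<longleftrightarrow> (\<forall>p\<in>J. \<forall>q\<in>J. (if E p q then 0 else Re (w p * w q)) = 0)"
    unfolding P_def using fin nonneg by (simp add: sum_nonneg_eq_0_iff sum_nonneg)
  also have "\<dots> \<longleftrightarrow> (\<forall>p\<in>J. \<forall>q\<in>J. E p q)"
  proof (intro ball_cong refl)
    fix p q assume "p \<in> J" "q \<in> J"
    then have "Re (w p * w q) \<noteq> 0" if "\<not> E p q"
      using half[of p q] that by linarith
    then show "(if E p q then 0 else Re (w p * w q)) = 0 \<longleftrightarrow> E p q"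
      by metis
  qed
  finally have PE: "P = 0 \<longleftrightarrow> (\<forall>p\<in>J. \<forall>q\<in>J. E p q)" .
  also have "\<dots> \<longleftrightarrow> even_family n s g"
    by (auto simp: even_family_def E_def J_def f_def all_even_signed_vec_iff)
  finally have Peq: "P = 0 \<longleftrightarrow> even_family n s g" .
  \<comment> \<open>A zero-sum triple would contain a non-even pair, and \<open>P = 0\<close> leaves
    none.\<close>
  have T0: "T = 0" if "P = 0"
  proof -
    have "E p q" if "p \<in> J" "q \<in> J" for p q
      using that \<open>P = 0\<close> PE by blast
    then have "\<not> Z p q r" if "p \<in> J" "q \<in> J" "r \<in> J" for p q r
      using not_all_even_if_sum_cong_0[OF I, of r p q] that
      by (auto simp: J_def E_def Z_def f_def)
    then show ?thesis
      by (simp add: T_def)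
  qed
  have le: "4 ^ n * (3 * (m\<^sup>2 - P) + T) \<le> 4 ^ n * (3 * m\<^sup>2)"
    using TP P0 by simp
  \<comment> \<open>Equality says \<open>T = 3 * P\<close>; with \<open>T \<le> P\<close> and
    \<open>0 \<le> P\<close> this forces \<open>P = 0\<close>. The converse is
    \<open>T0\<close>.\<close>
  have eq: "4 ^ n * (3 * (m\<^sup>2 - P) + T) = 4 ^ n * (3 * m\<^sup>2) \<longleftrightarrow> P = 0"
    using TP P0 T0 by auto
  have C: "3 * 2 ^ (2 * n) * m\<^sup>2 = 4 ^ n * (3 * m\<^sup>2)"
    by (simp add: power_mult)
  have "F_odd3 n s g = of_real c \<longleftrightarrow> Re (F_odd3 n s g) = c" for c
    using F_real by (auto simp: complex_eq_iff complex_is_Real_iff)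
  with F_real ReF le eq Peq show ?thesis
    unfolding m_def[symmetric] C by (simp only: simp_thms)
qed

end
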